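(* Let $n,k\ge 1$, let $X_1,\dots,X_k\in H_n(\mathbb{C})$ be linearly independent over $\mathbb{R}$, and write $\mathbf{X}=(X_1,\dots,X_k)$. Let $D\in\mathcal{D}(\mathbf{X})$ be a density of rank $r$, written as $D=YRY^*$ with $Y\in M_{n\times r}(\mathbb{C})$ and $R\in H_r(\mathbb{C})$. Then the following are equivalent: (i) $D$ is an extreme point of the convex set $\mathcal{D}(\mathbf{X})$; (ii) $\operatorname{span}_{\mathbb{R}}\{Y^*X_1Y,\dots,Y^*X_kY,\,Y^*Y\}=H_r(\mathbb{C})$; (iii) the system $\{DX_1D,\dots,DX_kD,\,D^2\}$ has real rank $r^2$, i.e. its real linear span has dimension $r^2$ over $\mathbb{R}$. Moreover, if $D=YY^*$ (that is, $R=I_r$), then each of (i), (ii) and (iii) is equivalent to (iv) $r^{-1}I_r$ is an extreme density with respect to $Y^*\mathbf{X}Y:=(Y^*X_1Y,\dots,Y^*X_kY)$; that is, $\mathcal{D}(Y^*\mathbf{X}Y)=\{r^{-1}I_r\}$.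
   Context: $H_m(\mathbb{C})$ denotes the real vector space of $m\times m$ complex Hermitian matrices. A density (matrix) in $M_m(\mathbb{C})$ is a positive semidefinite matrix $D$ with $\operatorname{Tr}D=1$. For a tuple $\mathbf{X}=(X_1,\dots,X_k)$ of matrices in $H_m(\mathbb{C})$, $$\mathcal{D}(\mathbf{X}):=\{D\in M_m(\mathbb{C}) : D \text{ is a density and } \operatorname{Tr}DX_i=0 \text{ for every } 1\le i\le k\}.$$ For the tuple $Y^*\mathbf{X}Y$ of $r\times r$ Hermitian matrices, $\mathcal{D}(Y^*\mathbf{X}Y)$ is defined in the same way with $m=r$. For a density $D$, the covariance matrix $\operatorname{Var}_D(\mathbf{X})$ is the $k\times k$ matrix with entries $\operatorname{Var}_D(\mathbf{X})_{ij}=\operatorname{Tr}DX_iX_j-(\operatorname{Tr}DX_i)(\operatorname{Tr}DX_j)$. A density $D$ is called extreme with respect to $\mathbf{X}$ if whenever $D=\sum_l\lambda_lD_l$ and $\operatorname{Var}_D(\mathbf{X})=\sum_l\lambda_l\operatorname{Var}_{D_l}(\mathbf{X})$ for finitely many densities $D_l$ and scalars $0<\lambda_l<1$ with $\sum_l\lambda_l=1$, one has $D_l=D$ for every $l$. *)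

theory Defs
  imports "HOL-Analysis.Analysis"
begin

definition adj :: "complex^'n^'m \<Rightarrow> complex^'m^'n" where
  "adj A = (\<chi> i j. cnj (A $ j $ i))"

definition hermitian :: "complex^'m^'m \<Rightarrow> bool" where
  "hermitian A \<longleftrightarrow> adj A = A"

text \<open>For Hermitian \<open>A\<close> the form \<open>v\<^sup>* A v\<close> is real, so taking the real part loses nothing.\<close>

definition psd :: "complex^'m^'m \<Rightarrow> bool" where
  "psd A \<longleftrightarrow> hermitian A \<and> (\<forall>v. 0 \<le> Re (\<Sum>i\<in>UNIV. cnj (v $ i) * (A *v v) $ i))"

definition density :: "complex^'m^'m \<Rightarrow> bool" where
  "density D \<longleftrightarrow> psd D \<and> trace D = 1"

definition density_set :: "('k::finite \<Rightarrow> complex^'m^'m) \<Rightarrow> (complex^'m^'m) set" where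
  "density_set X = {D. density D \<and> (\<forall>i. trace (D ** X i) = 0)}"

text \<open>The entries of the covariance matrix are complex in general, as \<open>X i ** X j\<close> need not be
  Hermitian.\<close>

definition Var :: "complex^'m^'m \<Rightarrow> ('k::finite \<Rightarrow> complex^'m^'m) \<Rightarrow> complex^'k^'k" where
  "Var D X = (\<chi> i j. trace (D ** X i ** X j) - trace (D ** X i) * trace (D ** X j))"

definition extreme_density :: "complex^'m^'m \<Rightarrow> ('k::finite \<Rightarrow> complex^'m^'m) \<Rightarrow> bool" where
  "extreme_density D X \<longleftrightarrow> density D \<and>
     (\<forall>(N::nat) (E :: nat \<Rightarrow> complex^'m^'m) (c :: nat \<Rightarrow> real).
        (\<forall>l<N. density (E l) \<and> 0 < c l \<and> c l < 1) \<and> (\<Sum>l<N. c l) = 1 \<and>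
        D = (\<Sum>l<N. c l *\<^sub>R E l) \<and> Var D X = (\<Sum>l<N. c l *\<^sub>R Var (E l) X)
        \<longrightarrow> (\<forall>l<N. E l = D))"

lemma psd_scaleR_add:
  fixes A B :: "complex^'m^'m"
  assumes "psd A" "psd B" "0 \<le> u" "0 \<le> v"
  shows "psd (u *\<^sub>R A + v *\<^sub>R B)"
proof -
  have "(\<Sum>i\<in>UNIV. cnj (w $ i) * ((u *\<^sub>R A + v *\<^sub>R B) *v w) $ i)
      = u *\<^sub>R (\<Sum>i\<in>UNIV. cnj (w $ i) * (A *v w) $ i)
        + v *\<^sub>R (\<Sum>i\<in>UNIV. cnj (w $ i) * (B *v w) $ i)" for w :: "complex^'m"
    by (simp add: matrix_vector_mult_def scaleR_sum_right sum_distrib_left sum.distrib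
        algebra_simps)
  moreover have "hermitian (u *\<^sub>R A + v *\<^sub>R B)"
    using assms(1,2) by (simp add: psd_def hermitian_def adj_def vec_eq_iff)
  ultimately show ?thesis
    using assms by (simp add: psd_def)
qed

lemma convex_density_set:
  fixes X :: "'k::finite \<Rightarrow> complex^'m^'m"
  shows "convex (density_set X)"
proof (rule convexI)
  fix A B :: "complex^'m^'m" and u v :: real
  assume AB: "A \<in> density_set X" "B \<in> density_set X" and uv: "0 \<le> u" "0 \<le> v" "u + v = 1"
  have tr: "trace ((u *\<^sub>R A + v *\<^sub>R B) ** C) = u *\<^sub>R trace (A ** C) + v *\<^sub>R trace (B ** C)"
    for C :: "complex^'m^'m"
    by (simp add: trace_def matrix_matrix_mult_def scaleR_sum_right
        sum.distrib algebra_simps)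
  have "trace (u *\<^sub>R A + v *\<^sub>R B) = 1"
    using tr[of "mat 1"] AB uv
    by (simp add: density_set_def density_def scaleR_conv_of_real flip: of_real_add)
  then show "u *\<^sub>R A + v *\<^sub>R B \<in> density_set X"
    using AB uv by (simp add: density_set_def density_def psd_scaleR_add tr)
qed

end

theory Submission imports Defs begin

text \<open>Write \<open>D = Y R Y\<^sup>*\<close> with \<open>Y\<close> injective and \<open>R\<close> positive definite. Every perturbation of \<open>D\<close> inside
  the positive semidefinite cone, in both directions, has the form \<open>Y S Y\<^sup>*\<close> with \<open>S\<close> Hermitian,
  and it stays in the density set iff \<open>S\<close> is orthogonal to every \<open>Y\<^sup>* X\<^sub>i Y\<close> and to \<open>Y\<^sup>* Y\<close>. So \<open>D\<close> is
  extreme iff only \<open>S = 0\<close> is orthogonal to these matrices, i.e. iff they span the Hermitian matrices.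
  The injective map \<open>A \<mapsto> Y R A R Y\<^sup>*\<close> turns this into the dimension count (iii). For (iv) the same
  criterion is applied to \<open>r\<^sup>-\<^sup>1 I\<close> and the compressed tuple.\<close>

subsection \<open>Hermitian matrices and the real inner product\<close>

lemma adj_adj [simp]: "adj (adj A) = A"
  by (simp add: adj_def vec_eq_iff)

lemma adj_mult: "adj (A ** B) = adj B ** adj A"
  by (simp add: adj_def vec_eq_iff matrix_matrix_mult_def mult.commute)

lemma adj_add: "adj (A + B) = adj A + adj B"
  and adj_scaleR: "adj (c *\<^sub>R A) = c *\<^sub>R adj A"
  by (simp_all add: adj_def vec_eq_iff)

lemma adj_mat_1 [simp]: "adj (mat 1) = mat 1"
  by (auto simp: adj_def mat_def vec_eq_iff)

lemma linear_sandwich: "linear (\<lambda>Z. A ** Z ** B)"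
  for A :: "complex^'n^'m" and B :: "complex^'q^'p"
  by (rule linearI)
    (simp_all add: vec_eq_iff matrix_matrix_mult_def sum.distrib sum_distrib_left sum_distrib_right
      scaleR_sum_right algebra_simps)

lemma linear_trace_mult_left: "linear (\<lambda>A. trace (A ** B))"
  for B :: "complex^'m^'n"
  by (rule linearI)
    (simp_all add: trace_def matrix_matrix_mult_def sum.distrib scaleR_sum_right algebra_simps)

lemma linear_trace: "linear (trace :: complex^'m^'m \<Rightarrow> complex)"
  using linear_trace_mult_left[of "mat 1"] by simp

lemma scaleR_matrix_mult:
  fixes A :: "complex^'n^'m" and B :: "complex^'q^'n"
  shows "(c *\<^sub>R A) ** B = c *\<^sub>R (A ** B)" and "A ** (c *\<^sub>R B) = c *\<^sub>R (A ** B)"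
  using linear_scale[OF linear_sandwich[of "mat 1" B]] linear_scale[OF linear_sandwich[of A "mat 1"]]
  by simp_all

lemma subspace_hermitian: "subspace {A. hermitian A}"
  by (auto simp: subspace_def hermitian_def adj_add adj_scaleR) (simp add: adj_def vec_eq_iff)

lemma hermitian_cnj_nth: "hermitian A \<Longrightarrow> cnj (A $ i $ j) = A $ j $ i"
  unfolding hermitian_def adj_def vec_eq_iff by simp

lemma hermitian_mat_1: "hermitian (mat 1)"
  by (simp add: hermitian_def)

lemma hermitian_sandwich: "hermitian Z \<Longrightarrow> hermitian (A ** Z ** adj A)"
  by (simp add: hermitian_def adj_mult matrix_mul_assoc)

lemma hermitian_compress: "hermitian Z \<Longrightarrow> hermitian (adj A ** Z ** A)"
  using hermitian_sandwich[of Z "adj A"] by simp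

lemma hermitian_gram: "hermitian (adj A ** A)"
  by (simp add: hermitian_def adj_mult)

text \<open>The library's real inner product on complex vectors is the real part of the Hermitian
  form. This lets \<open>psd\<close>, continuity and compactness arguments all run in Euclidean
  space.\<close>

lemma inner_vec_complex: "v \<bullet> w = Re (\<Sum>i\<in>UNIV. cnj (v $ i) * w $ i)"
  by (simp add: inner_vec_def inner_complex_def)

lemma matrix_vector_mult_scaleR_complex:
  fixes A :: "complex^'n^'m"
  shows "A *v (c *\<^sub>R v) = c *\<^sub>R (A *v v)" and "(c *\<^sub>R A) *v v = c *\<^sub>R (A *v v)"
  by (simp_all add: matrix_vector_mult_def vec_eq_iff scaleR_sum_right)

lemma psd_inner: "psd A \<longleftrightarrow> hermitian A \<and> (\<forall>v. 0 \<le> v \<bullet> (A *v v))"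
  by (simp add: psd_def inner_vec_complex)

lemma inner_adj: "v \<bullet> (A *v w) = (adj A *v v) \<bullet> w"
proof -
  have "(\<Sum>i\<in>UNIV. cnj (v $ i) * (A *v w) $ i) = (\<Sum>i\<in>UNIV. \<Sum>j\<in>UNIV. cnj (v $ i) * A $ i $ j * w $ j)"
    by (simp add: matrix_vector_mult_def sum_distrib_left mult.assoc)
  also have "\<dots> = (\<Sum>j\<in>UNIV. \<Sum>i\<in>UNIV. cnj (v $ i) * A $ i $ j * w $ j)"
    by (rule sum.swap)
  also have "\<dots> = (\<Sum>j\<in>UNIV. cnj ((adj A *v v) $ j) * w $ j)"
    by (simp add: matrix_vector_mult_def adj_def sum_distrib_left sum_distrib_right mult_ac)
  finally show ?thesis
    by (simp add: inner_vec_complex)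
qed

text \<open>Conjugation turns the trace into that of the adjoint, which cyclicity turns back, so the
  value is real. Its real part, read entrywise, is the Euclidean inner product, so trace conditions
  become orthogonality.\<close>

lemma trace_mult_hermitian:
  assumes "hermitian S" "hermitian Z"
  shows "trace (S ** Z) = of_real (S \<bullet> Z)"
proof -
  have "cnj (trace (S ** Z)) = trace (adj (S ** Z))"
    by (simp add: trace_def adj_def)
  also have "\<dots> = trace (S ** Z)"
    using assms trace_mul_sym[of Z S] by (simp add: adj_mult hermitian_def)
  finally have real: "trace (S ** Z) = of_real (Re (trace (S ** Z)))"
    by (simp add: complex_eq_iff)
  have "trace (S ** Z) = (\<Sum>i\<in>UNIV. \<Sum>j\<in>UNIV. cnj (S $ j $ i) * Z $ j $ i)"
    unfolding trace_def matrix_matrix_mult_def by (simp add: hermitian_cnj_nth[OF assms(1)])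
  also have "\<dots> = (\<Sum>j\<in>UNIV. \<Sum>i\<in>UNIV. cnj (S $ j $ i) * Z $ j $ i)"
    by (rule sum.swap)
  finally have "Re (trace (S ** Z)) = S \<bullet> Z"
    by (simp add: inner_vec_def inner_complex_def)
  then show ?thesis
    using real by simp
qed

text \<open>A proper subspace of the real space of Hermitian matrices has a nonzero Hermitian vector
  orthogonal to it, and the trace pairing is the inner product there.\<close>

lemma span_eq_hermitian_iff:
  assumes "\<And>Z. Z \<in> B \<Longrightarrow> hermitian Z"
  shows "span B = {A. hermitian A} \<longleftrightarrow>
    (\<forall>S. hermitian S \<and> (\<forall>Z\<in>B. trace (S ** Z) = 0) \<longrightarrow> S = 0)"
proof
  assume span: "span B = {A. hermitian A}"
  show "\<forall>S. hermitian S \<and> (\<forall>Z\<in>B. trace (S ** Z) = 0) \<longrightarrow> S = 0"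
  proof (intro allI impI, elim conjE)
    fix S assume S: "hermitian S" "\<forall>Z\<in>B. trace (S ** Z) = 0"
    have "orthogonal S Z" if "Z \<in> B" for Z
      using S that assms trace_mult_hermitian[of S Z] by (simp add: orthogonal_def)
    then have "orthogonal S S"
      using orthogonal_to_span span S(1) by blast
    then show "S = 0"
      by (simp add: orthogonal_def)
  qed
next
  assume S: "\<forall>S. hermitian S \<and> (\<forall>Z\<in>B. trace (S ** Z) = 0) \<longrightarrow> S = 0"
  have span_herm: "span {A. hermitian A} = {A::complex^_^_. hermitian A}"
    by (simp add: subspace_hermitian)
  have sub: "span B \<subseteq> {A. hermitian A}"
    using assms span_minimal subspace_hermitian by blast
  show "span B = {A. hermitian A}"
  proof (rule ccontr)
    assume "span B \<noteq> {A. hermitian A}"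
    then have "span B \<subset> span {A. hermitian A}"
      using sub span_herm by blast
    then obtain x where "x \<noteq> 0" "hermitian x" "\<And>y. y \<in> span B \<Longrightarrow> orthogonal x y"
      using orthogonal_to_subspace_exists_gen span_herm by (metis mem_Collect_eq)
    then show False
      using S trace_mult_hermitian assms by (metis of_real_0 orthogonal_def span_base)
  qed
qed

text \<open>The map \<open>A \<mapsto> Re A + Im A\<close> identifies the Hermitian matrices with all real matrices:
  its symmetric part is \<open>Re A\<close> and its skew part is \<open>Im A\<close>.\<close>

lemma dim_hermitian: "dim {A :: complex^'r^'r. hermitian A} = CARD('r)\<^sup>2"
proof -
  define f :: "complex^'r^'r \<Rightarrow> real^'r^'r" where "f A = (\<chi> i j. Re (A $ i $ j) + Im (A $ i $ j))" for A
  have lin: "linear f"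
    by (rule linearI) (simp_all add: f_def vec_eq_iff algebra_simps)
  have inj: "inj_on f {A. hermitian A}"
  proof (rule inj_onI, clarify)
    fix A B assume AB: "hermitian A" "hermitian B" "f A = f B"
    have "A $ i $ j = B $ i $ j" for i j
    proof -
      have "cnj (A $ i $ j) = A $ j $ i" "cnj (B $ i $ j) = B $ j $ i"
        using AB by (simp_all add: hermitian_cnj_nth)
      then have "Re (A $ j $ i) = Re (A $ i $ j)" "Im (A $ j $ i) = - Im (A $ i $ j)"
        "Re (B $ j $ i) = Re (B $ i $ j)" "Im (B $ j $ i) = - Im (B $ i $ j)"
        by (metis cnj.sel)+
      moreover have "f A $ i $ j = f B $ i $ j" "f A $ j $ i = f B $ j $ i"
        using AB by simp_all
      ultimately show ?thesis
        by (simp add: f_def complex_eq_iff)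
    qed
    then show "A = B"
      by (simp add: vec_eq_iff)
  qed
  have "M \<in> f ` {A. hermitian A}" for M
  proof -
    define A :: "complex^'r^'r" where
      "A = (\<chi> i j. Complex ((M $ i $ j + M $ j $ i) / 2) ((M $ i $ j - M $ j $ i) / 2))"
    have "hermitian A"
      by (simp add: A_def hermitian_def adj_def vec_eq_iff complex_eq_iff)
        (simp add: field_simps)
    moreover have "f A = M"
      by (simp add: f_def A_def vec_eq_iff field_simps)
    ultimately show ?thesis
      by blast
  qed
  then have "f ` {A. hermitian A} = UNIV"
    by blast
  then have "dim (UNIV :: (real^'r^'r) set) = dim {A :: complex^'r^'r. hermitian A}"
    using dim_image_eq[OF lin, of "{A. hermitian A}"] inj
      span_eq_iff[THEN iffD2, OF subspace_hermitian] by metis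
  then show ?thesis
    by (simp add: power2_eq_square)
qed

subsection \<open>Positive semidefinite matrices\<close>

lemma psd_sandwich: "psd Z \<Longrightarrow> psd (A ** Z ** adj A)"
  by (auto simp: psd_inner hermitian_sandwich inner_adj[of _ A] simp flip: matrix_vector_mul_assoc)

text \<open>With \<open>w = A *v v\<close>, the form at \<open>v + t *\<^sub>R w\<close> has no
  constant term and linear term \<open>2 * t * (w \<bullet> w)\<close>, so if \<open>w\<close> were
  nonzero, a small negative \<open>t\<close> would make it negative.\<close>

lemma psd_kernel:
  assumes "psd A" "v \<bullet> (A *v v) = 0"
  shows "A *v v = 0"
proof (rule ccontr)
  assume "A *v v \<noteq> 0"
  define w p c where "w = A *v v" and "p = w \<bullet> w" and "c = w \<bullet> (A *v w)"
  have "p > 0" "c \<ge> 0"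
    using \<open>A *v v \<noteq> 0\<close> assms by (auto simp: w_def p_def c_def psd_inner)
  have vw: "v \<bullet> (A *v w) = p"
    using assms(1) by (simp add: inner_adj psd_inner hermitian_def p_def flip: w_def)
  \<comment> \<open>The quadratic \<open>2 * t * p + t\<^sup>2 * c\<close> has its minimum at
    \<open>- p / c\<close>; the added 1 keeps the denominator positive when
    \<open>c = 0\<close>.\<close>
  define t where "t = - p / (c + 1)"
  have "0 \<le> (v + t *\<^sub>R w) \<bullet> (A *v (v + t *\<^sub>R w))"
    using assms by (simp add: psd_inner)
  also have "\<dots> = 2 * t * p + t\<^sup>2 * c"
    using assms(2) vw
    unfolding matrix_vector_right_distrib matrix_vector_mult_scaleR_complex inner_add_left inner_add_right
      inner_scaleR_left inner_scaleR_right w_def[symmetric] c_def[symmetric] p_def[symmetric]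
    by (simp add: p_def[symmetric] w_def[symmetric] power2_eq_square algebra_simps)
  also have "\<dots> = - p\<^sup>2 * (c + 2) / (c + 1)\<^sup>2"
  proof -
    have "t * (c + 1) = - p"
      using \<open>c \<ge> 0\<close> by (simp add: t_def)
    then have "(2 * t * p + t\<^sup>2 * c) * (c + 1)\<^sup>2 = - p\<^sup>2 * (c + 2)"
      by algebra
    then show ?thesis
      using \<open>c \<ge> 0\<close> by (subst eq_divide_eq) auto
  qed
  also have "\<dots> < 0"
    using \<open>p > 0\<close> \<open>c \<ge> 0\<close> by (intro divide_neg_pos mult_neg_pos) auto
  finally show False
    by simp
qed

text \<open>Invertibility makes the form of \<open>R\<close> strictly positive off 0, hence bounded
  below by a positive constant on the compact unit sphere, where the form of \<open>S\<close> is
  bounded. Homogeneity extends the comparison to all vectors.\<close>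

lemma psd_invertible_perturb:
  fixes R S :: "complex^'r^'r"
  assumes "psd R" "R' ** R = mat 1" "hermitian S"
  obtains t where "t > 0" "psd (R + t *\<^sub>R S)" "psd (R - t *\<^sub>R S)"
proof -
  have pos: "0 < v \<bullet> (R *v v)" if "v \<noteq> 0" for v
  proof -
    have "R *v v \<noteq> 0"
      using assms(2) that by (metis matrix_vector_mul_assoc matrix_vector_mul_lid matrix_vector_mult_0_right)
    then show ?thesis
      using psd_kernel assms(1) by (metis order_le_less psd_inner)
  qed
  have cont: "continuous_on A (\<lambda>v. v \<bullet> (Z *v v))" for A and Z :: "complex^'r^'r"
    by (intro continuous_intros linear_continuous_on matrix_vector_mul_bounded_linear)
  have ne: "sphere (0 :: complex^'r) 1 \<noteq> {}"
    by simp
  obtain x where x: "x \<in> sphere 0 1" "\<And>y. y \<in> sphere 0 1 \<Longrightarrow> x \<bullet> (R *v x) \<le> y \<bullet> (R *v y)"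
    using continuous_attains_inf[OF compact_sphere ne cont[of _ R]] by blast
  obtain z where z: "\<And>y. y \<in> sphere 0 1 \<Longrightarrow> \<bar>y \<bullet> (S *v y)\<bar> \<le> \<bar>z \<bullet> (S *v z)\<bar>"
    using continuous_attains_sup[OF compact_sphere ne continuous_on_rabs[OF cont[of _ S]]] by blast
  define a b where "a = x \<bullet> (R *v x)" and "b = \<bar>z \<bullet> (S *v z)\<bar>"
  have "a > 0" "b \<ge> 0"
    using pos[of x] x(1) unfolding a_def b_def by fastforce+
  \<comment> \<open>Here \<open>a\<close> is the minimum of the form of \<open>R\<close> on the
    sphere and \<open>b\<close> the maximum of the absolute form of \<open>S\<close>;
    \<open>b\<close> may be 0, hence the added 1.\<close>
  define t where "t = a / (b + 1)"
  have "t > 0"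
    using \<open>a > 0\<close> \<open>b \<ge> 0\<close> by (simp add: t_def)
  have "t * b \<le> a"
    using \<open>a > 0\<close> \<open>b \<ge> 0\<close> by (simp add: t_def field_simps)
  have le: "t * \<bar>v \<bullet> (S *v v)\<bar> \<le> v \<bullet> (R *v v)" for v
  proof (cases "v = 0")
    case False
    define u where "u = v /\<^sub>R norm v"
    have u: "u \<in> sphere 0 1" and v: "v = norm v *\<^sub>R u"
      using False by (simp_all add: u_def)
    have quad: "v \<bullet> (Z *v v) = (norm v)\<^sup>2 * (u \<bullet> (Z *v u))" for Z :: "complex^'r^'r"
      by (subst (1 2) v) (simp add: matrix_vector_mult_scaleR_complex power2_eq_square)
    have "t * \<bar>u \<bullet> (S *v u)\<bar> \<le> t * b"
      using z[OF u] \<open>t > 0\<close> by (simp add: b_def)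
    also have "\<dots> \<le> u \<bullet> (R *v u)"
      using \<open>t * b \<le> a\<close> x(2)[OF u] by (simp add: a_def)
    finally have "(norm v)\<^sup>2 * (t * \<bar>u \<bullet> (S *v u)\<bar>) \<le> (norm v)\<^sup>2 * (u \<bullet> (R *v u))"
      by (rule mult_left_mono) simp
    then show ?thesis
      by (simp add: quad abs_mult algebra_simps)
  qed simp
  have psd: "psd (R + s *\<^sub>R S)" if "\<bar>s\<bar> = t" for s
  proof -
    have "0 \<le> v \<bullet> ((R + s *\<^sub>R S) *v v)" for v
    proof -
      have "\<bar>s * (v \<bullet> (S *v v))\<bar> \<le> v \<bullet> (R *v v)"
        using le[of v] that by (simp add: abs_mult)
      then show ?thesis
        by (simp add: matrix_vector_mult_add_rdistrib inner_add_right matrix_vector_mult_scaleR_complex)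
    qed
    then show ?thesis
      using assms(1,3) by (simp add: psd_inner hermitian_def adj_add adj_scaleR)
  qed
  show ?thesis
    using that[of t] psd[of t] psd[of "- t"] \<open>t > 0\<close> by simp
qed

text \<open>\<open>Y ** L\<close> is a projection onto the range of \<open>D\<close>, and the kernel of \<open>D\<close> annihilates both
  summands because their forms are nonnegative.\<close>

lemma psd_summand_factor:
  assumes "psd a" "psd b" "u > 0" "v \<ge> 0"
    and D: "u *\<^sub>R a + v *\<^sub>R b = Y ** R ** adj Y" and L: "L ** Y = mat 1"
  shows "a = Y ** (L ** a ** adj L) ** adj Y"
proof -
  have herm: "adj a = a"
    using assms(1) by (simp add: psd_def hermitian_def)
  have LY: "adj Y ** adj L = mat 1"
    using L by (metis adj_mat_1 adj_mult)
  have "a *v (w - (adj L ** adj Y) *v w) = 0" for w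
  proof -
    \<comment> \<open>The matrix \<open>adj L ** adj Y\<close> is idempotent with the same kernel as
      \<open>adj Y\<close>, so \<open>x\<close> is the component of \<open>w\<close> that
      \<open>adj Y\<close> annihilates.\<close>
    define x where "x = w - (adj L ** adj Y) *v w"
    have "adj Y *v x = 0"
      by (simp add: x_def matrix_vector_mult_diff_distrib matrix_vector_mul_assoc matrix_mul_assoc LY)
    then have "x \<bullet> ((u *\<^sub>R a + v *\<^sub>R b) *v x) = 0"
      by (simp add: D flip: matrix_vector_mul_assoc)
    then have "u * (x \<bullet> (a *v x)) + v * (x \<bullet> (b *v x)) = 0"
      by (simp add: matrix_vector_mult_add_rdistrib matrix_vector_mult_scaleR_complex inner_add_right)
    moreover have "0 \<le> x \<bullet> (a *v x)" "0 \<le> x \<bullet> (b *v x)"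
      using assms(1,2) by (auto simp: psd_inner)
    ultimately have "x \<bullet> (a *v x) = 0"
      using assms(3,4) by (smt (verit) mult_nonneg_nonneg mult_pos_pos)
    then show ?thesis
      using psd_kernel assms(1) x_def by blast
  qed
  then have "a *v w = (a ** (adj L ** adj Y)) *v w" for w
    by (simp add: matrix_vector_mult_diff_distrib matrix_vector_mul_assoc)
  then have a1: "a = a ** (adj L ** adj Y)"
    by (subst matrix_eq) blast
  \<comment> \<open>Since \<open>a\<close> is Hermitian, taking adjoints moves the projection to the
    left side as well.\<close>
  then have "adj a = adj (a ** (adj L ** adj Y))"
    by simp
  then have "a = Y ** L ** a"
    by (simp add: adj_mult herm)
  then show ?thesis
    using a1 by (metis matrix_mul_assoc)
qed

subsection \<open>Extreme points of the density set\<close>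

lemma trace_sandwich: "trace (Y ** S ** adj Y ** Z) = trace (S ** (adj Y ** Z ** Y))"
  for Y :: "complex^'r^'n"
  by (metis matrix_mul_assoc trace_mul_sym)

text \<open>A left inverse of \<open>Y\<close> recovers the inner matrix, so passing from
  \<open>S\<close> to \<open>Y ** S ** adj Y\<close> loses nothing.\<close>

lemma sandwich_cancel:
  assumes "L ** Y = mat 1"
  shows "L ** (Y ** S ** adj Y) ** adj L = S"
proof -
  have "adj Y ** adj L = mat 1"
    using assms by (metis adj_mat_1 adj_mult)
  then show ?thesis
    using assms by (metis matrix_mul_assoc matrix_mul_lid matrix_mul_rid)
qed

lemma density_set_perturb:
  assumes "D \<in> density_set X" "psd (D + T)" "trace T = 0" "\<And>i. trace (T ** X i) = 0"
  shows "D + T \<in> density_set X"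
  using assms
  by (simp add: density_set_def density_def trace_add linear_add[OF linear_trace_mult_left])

text \<open>The factorisation is kept general because the criterion serves twice: for
  \<open>D\<close> itself, and for the normalised identity with \<open>Y = mat 1\<close>.\<close>

lemma extreme_point_density_set_iff:
  fixes X :: "'k::finite \<Rightarrow> complex^'n^'n" and Y :: "complex^'r^'n"
  assumes D: "D \<in> density_set X" "D = Y ** R ** adj Y"
    and R: "hermitian R" "R' ** R = mat 1" and L: "L ** Y = mat 1"
  shows "D extreme_point_of density_set X \<longleftrightarrow>
    (\<forall>S. hermitian S \<and> (\<forall>Z \<in> range (\<lambda>i. adj Y ** X i ** Y) \<union> {adj Y ** Y}. trace (S ** Z) = 0)
      \<longrightarrow> S = 0)"
    (is "_ = (\<forall>S. ?orth S \<longrightarrow> S = 0)")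
proof
  assume ext: "D extreme_point_of density_set X"
  show "\<forall>S. ?orth S \<longrightarrow> S = 0"
  proof (intro allI impI)
    fix S assume S: "?orth S"
    have "psd (L ** D ** adj L)"
      using D(1) by (simp add: density_set_def density_def psd_sandwich)
    then have "psd R"
      by (simp add: D(2) sandwich_cancel[OF L])
    then obtain t where t: "t > 0" "psd (R + t *\<^sub>R S)" "psd (R - t *\<^sub>R S)"
      using psd_invertible_perturb R S by blast
    \<comment> \<open>Adding or subtracting \<open>T\<close> replaces \<open>R\<close> by
      \<open>R + t *\<^sub>R S\<close> or \<open>R - t *\<^sub>R S\<close>, and orthogonality of
      \<open>S\<close> preserves all the trace conditions.\<close>
    define T where "T = Y ** (t *\<^sub>R S) ** adj Y"
    have lin: "linear (\<lambda>Z. Y ** Z ** adj Y)"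
      by (rule linear_sandwich)
    have tr: "trace (T ** Z) = t *\<^sub>R trace (S ** (adj Y ** Z ** Y))" for Z
      unfolding T_def trace_sandwich by (rule linear_scale[OF linear_trace_mult_left])
    have tr0: "trace T = 0" "trace (T ** X i) = 0" for i
      using S tr[of "mat 1"] tr[of "X i"] by simp_all
    have "D + T = Y ** (R + t *\<^sub>R S) ** adj Y" "D + (- T) = Y ** (R - t *\<^sub>R S) ** adj Y"
      using linear_add[OF lin] linear_diff[OF lin] by (simp_all add: D(2) T_def)
    then have "psd (D + T)" "psd (D + (- T))"
      using psd_sandwich t by metis+
    moreover have "trace (- T) = 0" "trace (- T ** X i) = 0" for i
      using tr0 linear_neg[OF linear_trace, of T] linear_neg[OF linear_trace_mult_left, of T "X i"]
      by simp_all
    ultimately have mem: "D + T \<in> density_set X" "D - T \<in> density_set X"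
      using density_set_perturb[OF D(1)] tr0 by fastforce+
    have "midpoint (D + T) (D - T) = D"
      by (simp add: midpoint_def scaleR_2[symmetric])
    then have "D \<notin> open_segment (D + T) (D - T) \<longrightarrow> D + T = D - T"
      by (metis midpoint_in_open_segment)
    then have "D + T = D - T"
      using ext mem by (auto simp: extreme_point_of_def)
    then have "2 *\<^sub>R T = 0"
      by (simp add: scaleR_2 algebra_simps)
    then have "t *\<^sub>R S = 0"
      using sandwich_cancel[OF L, of "t *\<^sub>R S"] linear_0[OF linear_sandwich, of L "adj L"]
      by (simp add: T_def)
    then show "S = 0"
      using t(1) by simp
  qed
next
  assume S: "\<forall>S. ?orth S \<longrightarrow> S = 0"
  have "D \<notin> open_segment a b" if ab: "a \<in> density_set X" "b \<in> density_set X" for a b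
  proof
    assume "D \<in> open_segment a b"
    then obtain u where u: "a \<noteq> b" "0 < u" "u < 1" "D = (1 - u) *\<^sub>R a + u *\<^sub>R b"
      by (auto simp: in_segment)
    have psd: "psd a" "psd b" and herm: "hermitian a" "hermitian b"
      using ab by (auto simp: density_set_def density_def psd_def)
    \<comment> \<open>Both endpoints factor through \<open>Y\<close>, so the direction of the
      segment is \<open>Y ** S ** adj Y\<close>; equal traces at \<open>a\<close> and
      \<open>b\<close> make \<open>S\<close> orthogonal to the whole system.\<close>
    define S where "S = L ** (a - b) ** adj L"
    have "a = Y ** (L ** a ** adj L) ** adj Y"
      using psd_summand_factor[OF psd, of "1 - u" u Y R L] u D(2) L by simp
    moreover have "b = Y ** (L ** b ** adj L) ** adj Y"
      using psd_summand_factor[OF psd(2,1), of u "1 - u" Y R L] u D(2) L by (simp add: add.commute)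
    ultimately have ab_S: "a - b = Y ** S ** adj Y"
      unfolding S_def using linear_diff[OF linear_sandwich] by metis
    have "hermitian (a - b)"
      using herm subspace_diff[OF subspace_hermitian] by blast
    then have "hermitian S"
      by (simp add: S_def hermitian_sandwich)
    moreover have "trace (S ** (adj Y ** X i ** Y)) = 0" for i
      using ab by (simp add: density_set_def linear_diff[OF linear_trace_mult_left] flip: trace_sandwich ab_S)
    moreover have "trace (S ** (adj Y ** Y)) = 0"
      using ab trace_sandwich[of Y S "mat 1"]
      by (simp add: density_set_def density_def linear_diff[OF linear_trace] flip: ab_S)
    ultimately have "S = 0"
      using S by blast
    then show False
      using ab_S u(1) linear_0[OF linear_sandwich, of Y "adj Y"] by simp
  qed
  then show "D extreme_point_of density_set X"
    using D(1) by (simp add: extreme_point_of_def)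
qed

section \<open>Finite mixtures and extremality with respect to covariance\<close>

text \<open>Collecting all summands but the \<open>l\<close>-th into one normalised mean
  \<open>z\<close> places \<open>x\<close> on the open segment between \<open>z\<close> and
  \<open>y l\<close>, the two-point situation.\<close>

lemma extreme_point_of_convex_sum:
  assumes "x extreme_point_of C" "convex C" "finite I"
    and "\<And>i. i \<in> I \<Longrightarrow> y i \<in> C" "\<And>i. i \<in> I \<Longrightarrow> 0 < c i" "sum c I = 1"
    and "x = (\<Sum>i\<in>I. c i *\<^sub>R y i)" "l \<in> I"
  shows "y l = x"
proof (rule ccontr)
  assume ne: "y l \<noteq> x"
  define J where "J = I - {l}"
  define z where "z = (\<Sum>i\<in>J. (c i / (1 - c l)) *\<^sub>R y i)"
  have c: "sum c J = 1 - c l" and x: "x = c l *\<^sub>R y l + (\<Sum>i\<in>J. c i *\<^sub>R y i)"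
    using assms sum.remove[OF assms(3,8), of c] sum.remove[OF assms(3,8), of "\<lambda>i. c i *\<^sub>R y i"]
    by (simp_all add: J_def)
  \<comment> \<open>If \<open>l\<close> were the only index, its weight would be 1 and
    \<open>y l\<close> would equal \<open>x\<close>. Hence \<open>c l < 1\<close>, and the division
    in \<open>z\<close> is legitimate.\<close>
  have "J \<noteq> {}"
    using ne x c by auto
  moreover have "finite J"
    using assms(3) by (simp add: J_def)
  ultimately have "0 < sum c J"
    using assms(5) by (intro sum_pos) (auto simp: J_def)
  then have cl: "0 < c l" "c l < 1"
    using assms(5,8) c by auto
  have "z \<in> C"
    unfolding z_def
  proof (rule convex_sum)
    show "(\<Sum>i\<in>J. c i / (1 - c l)) = 1"
      using c cl by (simp flip: sum_divide_distrib)
  qed (use assms cl in \<open>auto simp: J_def less_imp_le\<close>)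
  have xz: "x = c l *\<^sub>R y l + (1 - c l) *\<^sub>R z"
    unfolding z_def scaleR_sum_right using cl by (subst x) simp
  have "y l \<noteq> z"
    using ne xz by (metis add.commute diff_add_cancel scaleR_left_distrib scaleR_one)
  then have "x \<in> open_segment z (y l)"
    using xz cl by (auto simp: in_segment intro!: exI[of _ "c l"])
  then show False
    using assms(1,4,8) \<open>z \<in> C\<close> by (auto simp: extreme_point_of_def)
qed

text \<open>The covariance loses exactly the variance of the means \<open>Tr (D\<^sub>l X\<^sub>i)\<close> under mixing, so mixing
  without loss forces all means to vanish, i.e. the components lie in the density set.\<close>

lemma extreme_density_iff_extreme_point:
  fixes X :: "'k::finite \<Rightarrow> complex^'m^'m"
  assumes X: "\<And>i. hermitian (X i)" and D: "D \<in> density_set X"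
  shows "extreme_density D X \<longleftrightarrow> D extreme_point_of density_set X"
proof
  assume ext: "extreme_density D X"
  have "D \<notin> open_segment a b" if ab: "a \<in> density_set X" "b \<in> density_set X" for a b
  proof
    assume "D \<in> open_segment a b"
    then obtain u where u: "a \<noteq> b" "0 < u" "u < 1" "D = (1 - u) *\<^sub>R a + u *\<^sub>R b"
      by (auto simp: in_segment)
    define E where "E l = (if l = 0 then a else b)" for l :: nat
    define c where "c l = (if l = 0 then 1 - u else u)" for l :: nat
    \<comment> \<open>All means vanish on the density set, so \<open>Var\<close> is linear in the
      density there and every mixture inside the set preserves it.\<close>
    have var: "Var Z X = (\<chi> i j. trace (Z ** (X i ** X j)))" if "Z \<in> density_set X" for Z
      using that by (simp add: Var_def density_set_def matrix_mul_assoc)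
    have "Var D X = (1 - u) *\<^sub>R Var a X + u *\<^sub>R Var b X"
      unfolding var[OF D] var[OF ab(1)] var[OF ab(2)]
      by (simp add: vec_eq_iff u(4) linear_add[OF linear_trace_mult_left] linear_scale[OF linear_trace_mult_left])
    then have "(\<forall>l<2. density (E l) \<and> 0 < c l \<and> c l < 1) \<and> (\<Sum>l<2. c l) = 1 \<and>
        D = (\<Sum>l<2. c l *\<^sub>R E l) \<and> Var D X = (\<Sum>l<2. c l *\<^sub>R Var (E l) X)"
      using ab u by (simp add: E_def c_def density_set_def numeral_2_eq_2)
    then have "\<forall>l<2. E l = D"
      by (rule ext[unfolded extreme_density_def, THEN conjunct2, THEN spec, THEN spec, THEN spec, THEN mp])
    then have "E 0 = E 1"
      by simp
    then show False
      using u(1) by (simp add: E_def)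
  qed
  then show "D extreme_point_of density_set X"
    using D by (simp add: extreme_point_of_def)
next
  assume ext: "D extreme_point_of density_set X"
  show "extreme_density D X"
    unfolding extreme_density_def
  proof (intro conjI allI impI; (elim conjE)?)
    show "density D"
      using D by (simp add: density_set_def)
  next
    fix N l :: nat and E :: "nat \<Rightarrow> complex^'m^'m" and c :: "nat \<Rightarrow> real"
    assume E: "\<forall>l<N. density (E l) \<and> 0 < c l \<and> c l < 1" and c: "(\<Sum>l<N. c l) = 1"
      and DE: "D = (\<Sum>l<N. c l *\<^sub>R E l)" and var: "Var D X = (\<Sum>l<N. c l *\<^sub>R Var (E l) X)"
      and l: "l < N"
    have mem: "E m \<in> density_set X" if "m < N" for m
    proof -
      have "trace (E m ** X i) = 0" for i
      proof -
        have tr: "trace (E l ** X i) = of_real (E l \<bullet> X i)" if "l < N" for l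
          using E that by (intro trace_mult_hermitian X) (auto simp: density_def psd_def)
        have D0: "trace (D ** X i) = 0"
          using D by (simp add: density_set_def)
        have "trace (D ** (X i ** X i)) = (\<Sum>l<N. c l *\<^sub>R trace (E l ** (X i ** X i)))"
          unfolding DE linear_sum[OF linear_trace_mult_left]
          by (simp add: linear_scale[OF linear_trace_mult_left])
        \<comment> \<open>On the diagonal the second moments mix linearly and cancel. As the mean of
          \<open>D\<close> is 0, what remains is a vanishing weighted sum of squares of means, which
          are real.\<close>
        moreover have "Var D X $ i $ i = (\<Sum>l<N. c l *\<^sub>R Var (E l) X $ i $ i)"
          unfolding var by simp
        ultimately have "(\<Sum>l<N. c l *\<^sub>R (trace (E l ** X i) * trace (E l ** X i))) = 0"
          using D0 by (simp add: Var_def matrix_mul_assoc algebra_simps sum_subtractf)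
        then have "of_real (\<Sum>l<N. c l * (E l \<bullet> X i)\<^sup>2) = (0 :: complex)"
          by (simp add: tr power2_eq_square scaleR_conv_of_real)
        then have "(\<Sum>l<N. c l * (E l \<bullet> X i)\<^sup>2) = 0"
          unfolding of_real_eq_0_iff .
        then have "c m * (E m \<bullet> X i)\<^sup>2 = 0"
          using E that by (subst (asm) sum_nonneg_eq_0_iff) (auto simp: less_imp_le)
        then show ?thesis
          using E that tr by force
      qed
      then show ?thesis
        using E that by (simp add: density_set_def)
    qed
    show "E l = D"
      using extreme_point_of_convex_sum[OF ext convex_density_set, of "{..<N}" E c l] mem E c DE l
      by auto
  qed
qed

subsection \<open>Rank factorisations\<close>

text \<open>Rows of a product are linear combinations of the rows of the right factor, so the row
  space cannot grow.\<close>

lemma rank_mult_le_right: "rank (A ** B) \<le> rank B"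
  for A :: "'a::field^'r^'n" and B :: "'a^'m^'r"
proof -
  have "row i (A ** B) = (\<Sum>k\<in>UNIV. A $ i $ k *s row k B)" for i
    by (simp add: row_def matrix_matrix_mult_def vec_eq_iff)
  then have "rows (A ** B) \<subseteq> vec.span (rows B)"
    by (force simp: rows_def intro: vec.span_sum vec.span_scale vec.span_base)
  then show ?thesis
    unfolding row_rank_def_gen using vec.dim_subset vec.dim_span by metis
qed

text \<open>A dependence among the rows would put one row in the span of the others and push the
  rank below the number of rows.\<close>

lemma full_row_rank_right_inverse:
  fixes B :: "'a::field^'m^'r"
  assumes "CARD('r) \<le> rank B"
  obtains C where "B ** C = mat 1"
proof -
  have "c j = 0" if c: "(\<Sum>i\<in>UNIV. c i *s row i B) = 0" for c j
  proof (rule ccontr)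
    assume cj: "c j \<noteq> 0"
    define T where "T = (\<lambda>i. row i B) ` (UNIV - {j})"
    have "c j *s row j B = - (\<Sum>i\<in>UNIV - {j}. c i *s row i B)"
      using c by (simp add: sum.remove[of UNIV j] eq_neg_iff_add_eq_0)
    moreover have "(\<Sum>i\<in>UNIV - {j}. c i *s row i B) \<in> vec.span T"
      unfolding T_def by (intro vec.span_sum vec.span_scale vec.span_base imageI)
    ultimately have "inverse (c j) *s (c j *s row j B) \<in> vec.span T"
      by (metis vec.span_neg vec.span_scale)
    then have "row j B \<in> vec.span T"
      using cj by (simp add: vector_smult_assoc)
    moreover have "row i B \<in> vec.span T" if "i \<noteq> j" for i
      using that by (auto simp: T_def intro: vec.span_base)
    ultimately have "row i B \<in> vec.span T" for i
      by (cases "i = j") simp_all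
    then have "rows B \<subseteq> vec.span T"
      by (auto simp: rows_def)
    then have "rank B \<le> card T"
      unfolding row_rank_def_gen by (intro vec.dim_le_card) (simp_all add: T_def)
    also have "\<dots> \<le> card (UNIV - {j})"
      unfolding T_def by (rule card_image_le) simp
    also have "\<dots> < CARD('r)"
      by (rule psubset_card_mono) auto
    finally show False
      using assms by simp
  qed
  then show ?thesis
    using that matrix_right_invertible_independent_rows[of B] by metis
qed

text \<open>The rank hypothesis forces \<open>R ** adj Y\<close> to have full row rank; its right
  inverse \<open>C\<close> produces the inverses of both factors.\<close>

lemma rank_factorisation_inverses:
  fixes Y :: "complex^'r^'n" and R :: "complex^'r^'r"
  assumes "rank (Y ** R ** adj Y) = CARD('r)"
  obtains L R' where "L ** Y = mat 1" "R' ** R = mat 1" "R ** R' = mat 1"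
proof -
  have "CARD('r) \<le> rank (R ** adj Y)"
    using rank_mult_le_right[of Y "R ** adj Y"] assms by (simp add: matrix_mul_assoc)
  then obtain C where "(R ** adj Y) ** C = mat 1"
    by (rule full_row_rank_right_inverse)
  then have R: "R ** (adj Y ** C) = mat 1"
    by (simp add: matrix_mul_assoc)
  \<comment> \<open>One-sided inverses of square matrices are two-sided. Regrouped, this says that
    \<open>C ** R\<close> is a right inverse of \<open>adj Y\<close>, whose adjoint is the wanted
    \<open>L\<close>.\<close>
  then have R': "(adj Y ** C) ** R = mat 1"
    by (simp add: matrix_left_right_inverse)
  then have "adj (adj Y ** (C ** R)) = mat 1"
    by (simp add: matrix_mul_assoc)
  then have "adj (C ** R) ** Y = mat 1"
    by (simp add: adj_mult)
  then show ?thesis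
    using that R R' by blast
qed

section \<open>The equivalent conditions for a density of rank r\<close>

theorem theorem1:
  fixes X :: "'k::finite \<Rightarrow> complex^'n^'n"
    and D :: "complex^'n^'n"
    and Y :: "complex^'r^'n"
    and R :: "complex^'r^'r"
  assumes "\<forall>i. hermitian (X i)"
    and "inj X" and "independent (range X)"
    and "D \<in> density_set X"
    and "rank D = CARD('r)"
    and "hermitian R"
    and "D = Y ** R ** adj Y"
  shows
    "(D extreme_point_of density_set X \<longleftrightarrow>
        span (range (\<lambda>i. adj Y ** X i ** Y) \<union> {adj Y ** Y}) = {A. hermitian A}) \<and>
     (D extreme_point_of density_set X \<longleftrightarrow>
        dim (span (range (\<lambda>i. D ** X i ** D) \<union> {D ** D})) = CARD('r)\<^sup>2) \<and>
     (D = Y ** adj Y \<longrightarrow>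
       (D extreme_point_of density_set X \<longleftrightarrow>
          extreme_density ((1 / real CARD('r)) *\<^sub>R (mat 1 :: complex^'r^'r)) (\<lambda>i. adj Y ** X i ** Y)) \<and>
       (D extreme_point_of density_set X \<longleftrightarrow>
          density_set (\<lambda>i. adj Y ** X i ** Y) = {(1 / real CARD('r)) *\<^sub>R (mat 1 :: complex^'r^'r)}))"
proof -
  define Z where "Z i = adj Y ** X i ** Y" for i
  define B where "B = range Z \<union> {adj Y ** Y}"
  obtain L R' where L: "L ** Y = mat 1" and R': "R' ** R = mat 1" "R ** R' = mat 1"
    using rank_factorisation_inverses assms(5,7) by metis
  have hermZ: "hermitian (Z i)" for i
    using assms(1) by (simp add: Z_def hermitian_compress)
  have hermB: "hermitian A" if "A \<in> B" for A
    using that hermZ hermitian_gram by (auto simp: B_def)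
  have ext_iff: "D extreme_point_of density_set X \<longleftrightarrow>
      (\<forall>S. hermitian S \<and> (\<forall>A\<in>B. trace (S ** A) = 0) \<longrightarrow> S = 0)"
    using extreme_point_density_set_iff[OF assms(4,7,6) R'(1) L] by (simp add: B_def Z_def)
  also have "\<dots> \<longleftrightarrow> span B = {A. hermitian A}"
    using span_eq_hermitian_iff hermB by blast
  finally have i_ii: "D extreme_point_of density_set X \<longleftrightarrow> span B = {A. hermitian A}" .

  have "dim (span (range (\<lambda>i. D ** X i ** D) \<union> {D ** D})) = dim (span B)"
  proof -
    \<comment> \<open>Expanding both copies of \<open>D\<close> in \<open>D ** X i ** D\<close>
      gives \<open>f (Z i)\<close>, so \<open>f\<close> carries the system of (ii) to that of (iii);
      \<open>L\<close> and \<open>R'\<close> undo it.\<close>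
    define f where "f A = Y ** (R ** A ** R) ** adj Y" for A
    have lin: "linear f"
      unfolding f_def using linear_compose[OF linear_sandwich[of R R] linear_sandwich[of Y "adj Y"]]
      by (simp add: o_def)
    have "R' ** (L ** f A ** adj L) ** R' = A" for A
      unfolding f_def sandwich_cancel[OF L] using R' by (metis matrix_mul_assoc matrix_mul_lid matrix_mul_rid)
    then have inj: "inj f"
      by (metis injI)
    have "f (Z i) = D ** X i ** D" "f (adj Y ** Y) = D ** D" for i
      by (simp_all add: f_def Z_def assms(7) matrix_mul_assoc)
    then have "f ` B = range (\<lambda>i. D ** X i ** D) \<union> {D ** D}"
      by (auto simp: B_def image_Un image_image)
    then show ?thesis
      using dim_image_eq[OF lin, of B] inj by (simp add: inj_on_subset)
  qed
  also have "\<dots> = CARD('r)\<^sup>2 \<longleftrightarrow> span B = {A. hermitian A}"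
  proof
    assume "dim (span B) = CARD('r)\<^sup>2"
    then show "span B = {A. hermitian A}"
      by (intro subspace_dim_equal subspace_span subspace_hermitian span_minimal)
        (use hermB in \<open>auto simp: dim_hermitian\<close>)
  qed (simp add: dim_hermitian)
  finally have i_iii: "D extreme_point_of density_set X \<longleftrightarrow>
      dim (span (range (\<lambda>i. D ** X i ** D) \<union> {D ** D})) = CARD('r)\<^sup>2"
    using i_ii by simp

  define J :: "complex^'r^'r" where "J = (1 / real CARD('r)) *\<^sub>R mat 1"
  have iv: "(D extreme_point_of density_set X \<longleftrightarrow> extreme_density J Z) \<and>
      (D extreme_point_of density_set X \<longleftrightarrow> density_set Z = {J})" if DY: "D = Y ** adj Y"
  proof -
    have trY: "trace (adj Y ** Y) = 1"
      using assms(4) trace_mul_sym[of Y "adj Y"] by (simp add: density_set_def density_def DY)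
    have trZ: "trace (Z i) = 0" for i
      using assms(4) trace_sandwich[of Y "mat 1" "X i"]
      by (simp add: density_set_def DY Z_def)
    have hermJ: "hermitian J"
      by (simp add: J_def hermitian_def adj_scaleR)
    have trJ: "trace J = 1" and trJZ: "trace (J ** Z i) = 0" for i
      using linear_scale[OF linear_trace, of "1 / real CARD('r)" "mat 1 :: complex^'r^'r"]
        linear_scale[OF linear_trace_mult_left, of "1 / real CARD('r)" "mat 1" "Z i"] trZ
      by (simp_all add: J_def trace_I scaleR_conv_of_real)
    have "psd J"
      using hermJ by (simp add: J_def psd_inner matrix_vector_mult_scaleR_complex)
    then have J: "J \<in> density_set Z"
      using trJ trJZ by (simp add: density_set_def density_def)
    have inv: "(real CARD('r) *\<^sub>R mat 1) ** J = mat 1"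
      by (simp add: J_def scaleR_matrix_mult)
    have extJ: "J extreme_point_of density_set Z \<longleftrightarrow>
        (\<forall>S. hermitian S \<and> (\<forall>A \<in> range Z \<union> {mat 1}. trace (S ** A) = 0) \<longrightarrow> S = 0)"
      using extreme_point_density_set_iff[OF J _ hermJ inv, of "mat 1" "mat 1"] by simp
    \<comment> \<open>Adding a multiple of the identity, which is orthogonal to every \<open>Z i\<close>, exchanges
      orthogonality to \<open>adj Y ** Y\<close> and orthogonality to the identity.\<close>
    have transfer: "\<forall>S. hermitian S \<and> (\<forall>A \<in> range Z \<union> {Q}. trace (S ** A) = 0) \<longrightarrow> S = 0"
      if P: "\<forall>S. hermitian S \<and> (\<forall>A \<in> range Z \<union> {P}. trace (S ** A) = 0) \<longrightarrow> S = 0"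
        and PQ: "hermitian P" "trace P \<noteq> 0" "trace Q \<noteq> 0" for P Q
    proof (intro allI impI, elim conjE)
      fix S assume S: "hermitian S" "\<forall>A \<in> range Z \<union> {Q}. trace (S ** A) = 0"
      \<comment> \<open>The denominator is the trace of \<open>P\<close>, and \<open>s\<close> is
        the multiple that makes \<open>T\<close> orthogonal to \<open>P\<close>.\<close>
      define s where "s = (S \<bullet> P) / (mat 1 \<bullet> P)"
      define T where "T = S - s *\<^sub>R mat 1"
      have trT: "trace (T ** A) = trace (S ** A) - s *\<^sub>R trace A" for A
        unfolding T_def linear_diff[OF linear_trace_mult_left] linear_scale[OF linear_trace_mult_left]
        by simp
      have trP: "trace P = of_real (mat 1 \<bullet> P)"
        using trace_mult_hermitian[OF hermitian_mat_1 PQ(1)] by simp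
      have "hermitian T"
        using S(1) unfolding T_def hermitian_def by (simp add: adj_def vec_eq_iff mat_def)
      moreover have "trace (T ** P) = 0"
        using PQ(2) trP trace_mult_hermitian[OF S(1) PQ(1)]
        by (simp add: trT s_def scaleR_conv_of_real)
      moreover have "trace (T ** Z i) = 0" for i
        using S(2) by (simp add: trT trZ)
      ultimately have "T = 0"
        using P by blast
      then have "s *\<^sub>R trace Q = 0"
        using S(2) trT[of Q] by (simp add: trace_def)
      then show "S = 0"
        using PQ(3) \<open>T = 0\<close> by (simp add: T_def)
    qed
    have tr0: "trace (adj Y ** Y) \<noteq> 0" "trace (mat 1 :: complex^'r^'r) \<noteq> 0"
      by (simp_all add: trY trace_I)
    \<comment> \<open>The two directions use \<open>transfer\<close> with the Gram matrix and the
      identity in exchanged roles; both have nonzero trace.\<close>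
    have "D extreme_point_of density_set X \<longleftrightarrow> J extreme_point_of density_set Z"
      unfolding ext_iff extJ B_def
      by (rule iffI) (rule transfer[OF _ hermitian_gram tr0] transfer[OF _ hermitian_mat_1 tr0(2,1)], assumption)+
    moreover have "J extreme_point_of density_set Z \<longleftrightarrow> density_set Z = {J}"
    proof
      assume ext: "J extreme_point_of density_set Z"
      \<comment> \<open>Two members of the set differ by a Hermitian matrix orthogonal to every
        \<open>Z i\<close> and to the identity, which the criterion for \<open>J\<close> forces to
        be 0.\<close>
      have "E = J" if E: "E \<in> density_set Z" for E
      proof -
        have "hermitian (E - J)"
          using E hermJ subspace_diff[OF subspace_hermitian, of E J]
          by (simp add: density_set_def density_def psd_def)
        moreover have "trace ((E - J) ** A) = 0" if "A \<in> range Z \<union> {mat 1}" for A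
          using that E J unfolding linear_diff[OF linear_trace_mult_left]
          by (auto simp: density_set_def density_def)
        ultimately have "E - J = 0"
          using ext extJ by blast
        then show ?thesis
          by simp
      qed
      then show "density_set Z = {J}"
        using J by blast
    qed (simp add: extreme_point_of_def)
    ultimately show ?thesis
      using extreme_density_iff_extreme_point[OF hermZ J] by simp
  qed
  show ?thesis
    using i_ii i_iii iv unfolding B_def Z_def J_def by blast
qed

end
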